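(* Let $D$ be an oriented knot diagram, let $n\geq 1$, and let $D^{(n)}$ be the $n$-parallel of $D$. Fix any arc of $D$ and let $\gamma_1,\dots,\gamma_n$ be the corresponding $n$ parallel arcs of $D^{(n)}$ (numbered consecutively from one side to the other). Define a homomorphism $r:\mathrm{Col}_{\mathbb{Z}}(D^{(n)})\to\mathbb{Z}^n$ by \[ r(\mathcal{C})=(\mathcal{C}(\gamma_1),\dots,\mathcal{C}(\gamma_n)). \] Then $r$ is injective and its image $\mathrm{Im}\,r$ is equal to \[ \begin{cases} \{(a_1,\dots,a_n)\in\mathbb{Z}^n \mid w(a_1-a_2+a_3-\cdots-a_n)=0\} & \text{if } n \text{ is even},\\ \{(a,\dots,a)\mid a\in\mathbb{Z}\} & \text{if } n \text{ is odd and } w \text{ is odd},\\ \mathbb{Z}^n & \text{if } n \text{ is odd and } w \text{ is even}, \end{cases} \] where $w$ is the writhe of $D$.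
   Context: A $\mathbb{Z}$-coloring of a link diagram is a map $\gamma:\{\text{arcs}\}\to\mathbb{Z}$ such that $2\gamma(a)=\gamma(b)+\gamma(c)$ at each crossing with over arc $a$ and under arcs $b$ and $c$. $\mathrm{Col}_{\mathbb{Z}}(D)$ denotes the set of $\mathbb{Z}$-colorings of a link diagram $D$, which is an abelian group under pointwise addition. For a knot diagram $D$, the $n$-parallel $D^{(n)}$ is the diagram obtained by replacing the string of $D$ with $n$ parallel copies of it in the plane (each crossing of $D$ is replaced by $n^2$ crossings, in which the $n$ copies of the over strand pass over the $n$ copies of the under strand). For an arc of $D$, the corresponding $n$ arcs of $D^{(n)}$ are the arcs containing the $n$ parallel copies of that arc (away from the $n\times n$ crossing regions at which the arc of $D$ ends). *)

theory Defs
  imports "HOL-Algebra.Product_Groups"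
begin

text \<open>
  An oriented link diagram is given by its combinatorial data: the crossings with their signs, the
  oriented edges of the underlying 4-valent plane graph, and the edge that comes in to, respectively
  goes out of, each crossing on its over and its under strand. An edge at which no crossing sits is
  a component without crossings. On the sphere this determines a connected diagram up to
  isotopy; the choice of the unbounded region is irrelevant for colorings, writhe and parallels.
\<close>

datatype strand = Over | Under
datatype dir = In | Out

record ('x, 'e) diagram =
  crossings :: "'x set"
  edges :: "'e set"
  edge_at :: "'x \<Rightarrow> strand \<Rightarrow> dir \<Rightarrow> 'e"
  sign :: "'x \<Rightarrow> int"

text \<open>The classes of the equivalence relation generated by \<open>R\<close>\<close>

definition gen_classes :: "'a set \<Rightarrow> ('a \<times> 'a) set \<Rightarrow> 'a set set" where
  "gen_classes A R = A // (R \<union> converse R)\<^sup>*"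


subsection \<open>Planarity\<close>

text \<open>
  The counterclockwise successor of a half-edge at a crossing. At a positive crossing, if the over
  strand runs from west to east, then the under strand runs from south to north; at a negative
  crossing it runs from north to south.
\<close>

fun ccw_pos :: "strand \<times> dir \<Rightarrow> strand \<times> dir" where
  "ccw_pos (Over, Out) = (Under, Out)"
| "ccw_pos (Under, Out) = (Over, In)"
| "ccw_pos (Over, In) = (Under, In)"
| "ccw_pos (Under, In) = (Over, Out)"

fun ccw_neg :: "strand \<times> dir \<Rightarrow> strand \<times> dir" where
  "ccw_neg (Over, Out) = (Under, In)"
| "ccw_neg (Under, In) = (Over, In)"
| "ccw_neg (Over, In) = (Under, Out)"
| "ccw_neg (Under, Out) = (Over, Out)"

definition half_edges :: "('x, 'e) diagram \<Rightarrow> ('x \<times> strand \<times> dir) set" where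
  "half_edges D = crossings D \<times> UNIV"

text \<open>Follow a half-edge to the opposite end of its edge, and turn there.\<close>

definition face_step ::
    "('x, 'e) diagram \<Rightarrow> (('x \<times> strand \<times> dir) \<times> ('x \<times> strand \<times> dir)) set" where
  "face_step D =
    {((x, s, d), (y, (if sign D y = 1 then ccw_pos else ccw_neg) (t, d'))) | x s d y t d'.
      x \<in> crossings D \<and> y \<in> crossings D \<and> edge_at D x s d = edge_at D y t d' \<and> d \<noteq> d'}"

definition faces :: "('x, 'e) diagram \<Rightarrow> ('x \<times> strand \<times> dir) set set" where
  "faces D = gen_classes (half_edges D) (face_step D)"

definition pieces :: "('x, 'e) diagram \<Rightarrow> 'x set set" where
  "pieces D = gen_classes (crossings D)
    {(x, y). x \<in> crossings D \<and> y \<in> crossings D \<and> (\<exists>s t. edge_at D x s Out = edge_at D y t In)}"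

text \<open>
  Euler's formula, summed over the connected pieces of the underlying 4-valent graph. Every piece
  has Euler characteristic at most 2, so equality holds iff every piece is drawn on a sphere.
  The components without crossings are not counted.
\<close>

definition planar_diagram :: "('x, 'e) diagram \<Rightarrow> bool" where
  "planar_diagram D \<longleftrightarrow>
    int (card (crossings D))
      - int (card {edge_at D x s d | x s d. x \<in> crossings D}) + int (card (faces D))
    = 2 * int (card (pieces D))"


subsection \<open>Link and knot diagrams\<close>

definition well_formed :: "('x, 'e) diagram \<Rightarrow> bool" where
  "well_formed D \<longleftrightarrow>
    finite (crossings D) \<and> finite (edges D) \<and>
    (\<forall>x\<in>crossings D. sign D x \<in> {1, -1}) \<and>
    (\<forall>x\<in>crossings D. \<forall>s d. edge_at D x s d \<in> edges D) \<and>
    (\<forall>d. inj_on (\<lambda>(x, s). edge_at D x s d) (crossings D \<times> UNIV)) \<and>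
    {edge_at D x s In | x s. x \<in> crossings D} = {edge_at D x s Out | x s. x \<in> crossings D}"

definition link_diagram :: "('x, 'e) diagram \<Rightarrow> bool" where
  "link_diagram D \<longleftrightarrow> well_formed D \<and> planar_diagram D"

definition components :: "('x, 'e) diagram \<Rightarrow> 'e set set" where
  "components D = gen_classes (edges D) {(edge_at D x s In, edge_at D x s Out) | x s. x \<in> crossings D}"

definition knot_diagram :: "('x, 'e) diagram \<Rightarrow> bool" where
  "knot_diagram D \<longleftrightarrow> link_diagram D \<and> card (components D) = 1"

definition writhe :: "('x, 'e) diagram \<Rightarrow> int" where
  "writhe D = (\<Sum>x\<in>crossings D. sign D x)"


subsection \<open>Arcs and colorings\<close>

text \<open>An arc is represented by the set of the edges it consists of; it runs on at overcrossings.\<close>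

definition over_step :: "('x, 'e) diagram \<Rightarrow> ('e \<times> 'e) set" where
  "over_step D = {(edge_at D x Over In, edge_at D x Over Out) | x. x \<in> crossings D}"

definition arcs :: "('x, 'e) diagram \<Rightarrow> 'e set set" where
  "arcs D = gen_classes (edges D) (over_step D)"

definition arc_of :: "('x, 'e) diagram \<Rightarrow> 'e \<Rightarrow> 'e set" where
  "arc_of D e = (over_step D \<union> converse (over_step D))\<^sup>* `` {e}"

definition colorings :: "('x, 'e) diagram \<Rightarrow> ('e set \<Rightarrow> int) set" where
  "colorings D = {C \<in> arcs D \<rightarrow>\<^sub>E UNIV. \<forall>x\<in>crossings D.
    2 * C (arc_of D (edge_at D x Over In))
      = C (arc_of D (edge_at D x Under In)) + C (arc_of D (edge_at D x Under Out))}"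

definition coloring_group :: "('x, 'e) diagram \<Rightarrow> ('e set \<Rightarrow> int) monoid" where
  "coloring_group D = (product_group (arcs D) (\<lambda>_. integer_group))\<lparr>carrier := colorings D\<rparr>"

definition int_vectors :: "nat \<Rightarrow> (nat \<Rightarrow> int) monoid" where
  "int_vectors n = product_group {1..n} (\<lambda>_. integer_group)"


subsection \<open>Parallels\<close>

text \<open>
  The copies of a strand are numbered \<open>1, \<dots>, n\<close> from left to right with respect to its orientation.
  \<open>Copy e i\<close> is the part of the \<open>i\<close>-th copy of the edge \<open>e\<close> outside the crossing regions;
  \<open>Inner x s i p\<close> is the piece of the \<open>i\<close>-th copy of the strand \<open>s\<close> at \<open>x\<close> between the \<open>p\<close>-th and the
  \<open>p + 1\<close>-st of the \<open>n\<close> crossings that this copy meets there.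
  The crossing \<open>(x, i, j)\<close> is that of the \<open>i\<close>-th over copy with the \<open>j\<close>-th under copy at \<open>x\<close>.
\<close>

datatype ('x, 'e) parallel_edge = Copy 'e nat | Inner 'x strand nat nat

text \<open>
  At a positive crossing, the over strand meets the copies of the under strand from left to right,
  while the under strand comes from the right of the over strand and meets its copies from right to
  left; at a negative crossing it is the other way round. \<open>meet_pos n \<epsilon> s k\<close> is the position at which
  a copy of the strand \<open>s\<close> meets the \<open>k\<close>-th copy of the other strand.
\<close>

definition meet_pos :: "nat \<Rightarrow> int \<Rightarrow> strand \<Rightarrow> nat \<Rightarrow> nat" where
  "meet_pos n \<epsilon> s k = (if (s = Over) = (\<epsilon> = 1) then k else n + 1 - k)"

definition parallel_edge_at ::
    "nat \<Rightarrow> ('x, 'e) diagram \<Rightarrow> 'x \<times> nat \<times> nat \<Rightarrow> strand \<Rightarrow> dir \<Rightarrow> ('x, 'e) parallel_edge" where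
  "parallel_edge_at n D = (\<lambda>(x, i, j) s d.
    let c = (case s of Over \<Rightarrow> i | Under \<Rightarrow> j);
        k = (case s of Over \<Rightarrow> j | Under \<Rightarrow> i);
        p = meet_pos n (sign D x) s k
    in case d of
         In \<Rightarrow> if p = 1 then Copy (edge_at D x s In) c else Inner x s c (p - 1)
       | Out \<Rightarrow> if p = n then Copy (edge_at D x s Out) c else Inner x s c p)"

definition parallel ::
    "nat \<Rightarrow> ('x, 'e) diagram \<Rightarrow> ('x \<times> nat \<times> nat, ('x, 'e) parallel_edge) diagram" where
  "parallel n D =
    \<lparr>crossings = crossings D \<times> {1..n} \<times> {1..n},
     edges = {Copy e i | e i. e \<in> edges D \<and> i \<in> {1..n}}
       \<union> {Inner x s i p | x s i p. x \<in> crossings D \<and> i \<in> {1..n} \<and> p \<in> {1..<n}},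
     edge_at = parallel_edge_at n D,
     sign = (\<lambda>(x, i, j). sign D x)\<rparr>"

text \<open>
  The arc of the parallel that contains the \<open>i\<close>-th copies of the edges of the arc \<open>\<alpha>\<close>;
  these copies all lie on one arc, see \<open>parallel_arc_eq\<close> below.
\<close>

definition parallel_arc ::
    "nat \<Rightarrow> ('x, 'e) diagram \<Rightarrow> 'e set \<Rightarrow> nat \<Rightarrow> ('x, 'e) parallel_edge set" where
  "parallel_arc n D \<alpha> i = (\<Union>e\<in>\<alpha>. arc_of (parallel n D) (Copy e i))"


subsection \<open>Well-definedness\<close>

lemma arc_of_in_arcs: "e \<in> edges D \<Longrightarrow> arc_of D e \<in> arcs D"
  by (auto simp: arcs_def gen_classes_def arc_of_def intro: quotientI)

lemma subgroup_colorings: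
  assumes "well_formed D"
  shows "subgroup (colorings D) (product_group (arcs D) (\<lambda>_. integer_group))"
proof -
  have *: "arc_of D (edge_at D x s d) \<in> arcs D" if "x \<in> crossings D" for x s d
    using that assms by (auto simp: well_formed_def intro: arc_of_in_arcs)
  have inv: "inv\<^bsub>product_group (arcs D) (\<lambda>_. integer_group)\<^esub> C = (\<lambda>a\<in>arcs D. - C a)"
    if "C \<in> arcs D \<rightarrow>\<^sub>E UNIV" for C
    using that by (subst inv_product_group) (auto cong: restrict_cong)
  have grp: "group (product_group (arcs D) (\<lambda>_. integer_group))"
    by simp
  have zero: "(\<lambda>a\<in>arcs D. 0) \<in> colorings D"
    by (auto simp: colorings_def *)
  show ?thesis
  proof (rule group.subgroupI[OF grp])
    show "colorings D \<noteq> {}" using zero by blast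
  next
    fix C assume "C \<in> colorings D"
    then show "inv\<^bsub>product_group (arcs D) (\<lambda>_. integer_group)\<^esub> C \<in> colorings D"
      by (auto simp: colorings_def inv *)
  next
    fix C C' assume "C \<in> colorings D" "C' \<in> colorings D"
    then show "C \<otimes>\<^bsub>product_group (arcs D) (\<lambda>_. integer_group)\<^esub> C' \<in> colorings D"
      by (auto simp: colorings_def product_group_def * distrib_left)
  qed (auto simp: colorings_def)
qed

text \<open>The \<open>p\<close>-th crossing which the \<open>c\<close>-th copy of the strand \<open>s\<close> meets at \<open>x\<close>\<close>

definition nth_crossing ::
    "nat \<Rightarrow> ('x, 'e) diagram \<Rightarrow> 'x \<Rightarrow> strand \<Rightarrow> nat \<Rightarrow> nat \<Rightarrow> 'x \<times> nat \<times> nat" where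
  "nth_crossing n D x s c p = (let k = meet_pos n (sign D x) s p
    in case s of Over \<Rightarrow> (x, c, k) | Under \<Rightarrow> (x, k, c))"

lemma nth_crossing_in:
  "x \<in> crossings D \<Longrightarrow> c \<in> {1..n} \<Longrightarrow> p \<in> {1..n} \<Longrightarrow>
    nth_crossing n D x s c p \<in> crossings (parallel n D)"
  by (auto simp: nth_crossing_def parallel_def meet_pos_def split: strand.splits)

lemma nth_crossing_cases:
  assumes "y \<in> crossings (parallel n D)"
  obtains x c p where "x \<in> crossings D" "c \<in> {1..n}" "p \<in> {1..n}" "y = nth_crossing n D x s c p"
proof -
  obtain x i j where y: "y = (x, i, j)" "x \<in> crossings D" "i \<in> {1..n}" "j \<in> {1..n}"
    using assms by (auto simp: parallel_def)
  show ?thesis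
  proof (cases s)
    case Over
    with y show ?thesis
      by (intro that[of x i "meet_pos n (sign D x) s j"])
        (auto simp: nth_crossing_def meet_pos_def)
  next
    case Under
    with y show ?thesis
      by (intro that[of x j "meet_pos n (sign D x) s i"])
        (auto simp: nth_crossing_def meet_pos_def)
  qed
qed

lemma edge_at_nth_crossing:
  assumes "c \<in> {1..n}" "p \<in> {1..n}"
  shows "edge_at (parallel n D) (nth_crossing n D x s c p) s d = (case d of
      In \<Rightarrow> if p = 1 then Copy (edge_at D x s In) c else Inner x s c (p - 1)
    | Out \<Rightarrow> if p = n then Copy (edge_at D x s Out) c else Inner x s c p)"
  using assms
  by (auto simp: nth_crossing_def parallel_def parallel_edge_at_def meet_pos_def Let_def
      split: strand.splits dir.splits)

lemma well_formed_parallel: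
  assumes wf: "well_formed D" and "n \<ge> 1"
  shows "well_formed (parallel n D)"
proof -
  let ?P = "parallel n D"
  have fin: "finite (edges ?P)"
  proof -
    have "edges ?P \<subseteq> (\<lambda>(e, i). Copy e i) ` (edges D \<times> {1..n})
        \<union> (\<lambda>(x, s, i, p). Inner x s i p) ` (crossings D \<times> {Over, Under} \<times> {1..n} \<times> {1..<n})"
      by (auto simp: parallel_def image_iff) (metis strand.exhaust)
    then show ?thesis
      using wf by (auto simp: well_formed_def intro: finite_subset)
  qed
  have edge_in: "edge_at ?P y s d \<in> edges ?P" if y: "y \<in> crossings ?P" for y s d
  proof -
    obtain x c p where x: "x \<in> crossings D" "c \<in> {1..n}" "p \<in> {1..n}" "y = nth_crossing n D x s c p"
      using nth_crossing_cases[OF y] .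
    have "\<forall>s d. edge_at D x s d \<in> edges D"
      using wf x by (simp add: well_formed_def)
    then show ?thesis
      unfolding x(4) edge_at_nth_crossing[OF x(2,3)] using x
      by (cases d) (auto simp: parallel_def)
  qed
  have inj: "y = z \<and> s = t"
    if y: "y \<in> crossings ?P" and z: "z \<in> crossings ?P"
      and eq: "edge_at ?P y s d = edge_at ?P z t d" for y z s t d
  proof -
    obtain x c p where x: "x \<in> crossings D" "c \<in> {1..n}" "p \<in> {1..n}" "y = nth_crossing n D x s c p"
      using nth_crossing_cases[OF y] .
    obtain x' c' p' where x': "x' \<in> crossings D" "c' \<in> {1..n}" "p' \<in> {1..n}"
        "z = nth_crossing n D x' t c' p'"
      using nth_crossing_cases[OF z] .
    have D: "x = x' \<and> s = t" if "edge_at D x s d = edge_at D x' t d"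
    proof -
      have "inj_on (\<lambda>(x, s). edge_at D x s d) (crossings D \<times> UNIV)"
        using wf by (simp add: well_formed_def)
      from inj_onD[OF this, of "(x, s)" "(x', t)"] that x(1) x'(1) show ?thesis by simp
    qed
    have "x = x' \<and> s = t \<and> c = c' \<and> p = p'"
      using eq D x(2,3) x'(2,3)
      unfolding x(4) x'(4) edge_at_nth_crossing[OF x(2,3)] edge_at_nth_crossing[OF x'(2,3)]
      by (cases d) (auto split: if_splits)
    with x x' show ?thesis by simp
  qed
  have in_out: "{edge_at ?P y s d | y s. y \<in> crossings ?P} =
      {Copy (edge_at D x s d) c | x s c. x \<in> crossings D \<and> c \<in> {1..n}}
      \<union> {Inner x s c p | x s c p. x \<in> crossings D \<and> c \<in> {1..n} \<and> p \<in> {1..<n}}"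
    (is "?L = ?R") for d
  proof
    show "?L \<subseteq> ?R"
    proof
      fix f assume "f \<in> ?L"
      then obtain y s where y: "y \<in> crossings ?P" and f: "f = edge_at ?P y s d"
        by blast
      obtain x c p where x: "x \<in> crossings D" "c \<in> {1..n}" "p \<in> {1..n}"
          "y = nth_crossing n D x s c p"
        using nth_crossing_cases[OF y] .
      show "f \<in> ?R"
        unfolding f x(4) edge_at_nth_crossing[OF x(2,3)] using x(1-3) by (cases d) auto
    qed
    have mem: "f \<in> ?L" if "y \<in> crossings ?P" "edge_at ?P y s d = f" for f y s
      using that by blast
    have "Copy (edge_at D x s d) c \<in> ?L" if "x \<in> crossings D" "c \<in> {1..n}" for x s c
    proof (rule mem)
      let ?p = "if d = In then 1 else n"
      show "nth_crossing n D x s c ?p \<in> crossings ?P"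
        using that \<open>n \<ge> 1\<close> by (intro nth_crossing_in) auto
      show "edge_at ?P (nth_crossing n D x s c ?p) s d = Copy (edge_at D x s d) c"
        using that \<open>n \<ge> 1\<close> by (cases d) (auto simp: edge_at_nth_crossing)
    qed
    moreover have "Inner x s c p \<in> ?L" if "x \<in> crossings D" "c \<in> {1..n}" "p \<in> {1..<n}" for x s c p
    proof (rule mem)
      let ?p = "if d = In then p + 1 else p"
      show "nth_crossing n D x s c ?p \<in> crossings ?P"
        using that by (intro nth_crossing_in) auto
      show "edge_at ?P (nth_crossing n D x s c ?p) s d = Inner x s c p"
        using that by (cases d) (auto simp: edge_at_nth_crossing)
    qed
    ultimately show "?R \<subseteq> ?L" by blast
  qed
  have "{edge_at D x s In | x s. x \<in> crossings D} = {edge_at D x s Out | x s. x \<in> crossings D}"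
    using wf by (simp add: well_formed_def)
  then have D_io: "{edge_at D x s d | x s. x \<in> crossings D} = {edge_at D x s d' | x s. x \<in> crossings D}"
    for d d'
    by (cases d; cases d') (simp_all only:)
  have "\<exists>x' s'. x' \<in> crossings D \<and> edge_at D x s d = edge_at D x' s' d'"
    if "x \<in> crossings D" for x s d d'
  proof -
    have "edge_at D x s d \<in> {edge_at D x s d' | x s. x \<in> crossings D}"
      unfolding D_io[of d' d] using that by blast
    then show ?thesis by blast
  qed
  then have "{edge_at ?P y s d | y s. y \<in> crossings ?P}
      \<subseteq> {edge_at ?P y s d' | y s. y \<in> crossings ?P}" for d d'
    unfolding in_out by fast
  then have io: "{edge_at ?P y s In | y s. y \<in> crossings ?P}
      = {edge_at ?P y s Out | y s. y \<in> crossings ?P}"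
    by (meson subset_antisym)
  have "inj_on (\<lambda>(y, s). edge_at ?P y s d) (crossings ?P \<times> UNIV)" for d
    using inj by (auto simp: inj_on_def)
  moreover have "finite (crossings ?P)" "\<forall>y\<in>crossings ?P. sign ?P y \<in> {1, -1}"
    using wf by (auto simp: well_formed_def parallel_def)
  ultimately show ?thesis
    using fin edge_in io unfolding well_formed_def by blast
qed

lemma parallel_arc_eq:
  assumes "\<alpha> \<in> arcs D" and "e \<in> \<alpha>" and i: "i \<in> {1..n}"
  shows "parallel_arc n D \<alpha> i = arc_of (parallel n D) (Copy e i)"
proof -
  let ?P = "parallel n D"
  define R where "R = (over_step ?P \<union> converse (over_step ?P))\<^sup>*"
  define R0 where "R0 = (over_step D \<union> converse (over_step D))\<^sup>*"
  have sym: "sym R" "sym R0" and trans: "trans R" "trans R0"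
    unfolding R_def R0_def
    by (auto intro!: sym_rtrancl simp: sym_Un_converse trans_rtrancl)
  have over: "(Copy (edge_at D x Over In) i, Copy (edge_at D x Over Out) i) \<in> R"
    if x: "x \<in> crossings D" for x
  proof -
    have *: "(edge_at ?P (nth_crossing n D x Over i p) Over In,
        edge_at ?P (nth_crossing n D x Over i p) Over Out) \<in> R" if "p \<in> {1..n}" for p
      using nth_crossing_in[OF x i that, of Over]
      unfolding R_def over_step_def by (intro r_into_rtrancl UnI1 CollectI exI conjI) (rule refl)
    have "(Copy (edge_at D x Over In) i,
        edge_at ?P (nth_crossing n D x Over i p) Over Out) \<in> R" if "p \<in> {1..n}" for p
      using that
    proof (induction p)
      case (Suc p)
      show ?case
      proof (cases "p = 0")
        case True
        with *[OF Suc.prems] i Suc.prems show ?thesis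
          by (auto simp: edge_at_nth_crossing)
      next
        case False
        then have "(Copy (edge_at D x Over In) i,
            edge_at ?P (nth_crossing n D x Over i p) Over Out) \<in> R"
          using Suc by auto
        also have "edge_at ?P (nth_crossing n D x Over i p) Over Out
            = edge_at ?P (nth_crossing n D x Over i (Suc p)) Over In"
          using Suc.prems False i by (auto simp: edge_at_nth_crossing)
        finally show ?thesis
          using *[OF Suc.prems] trans(1) by (meson transD)
      qed
    qed simp
    from this[of n] i show ?thesis by (auto simp: edge_at_nth_crossing)
  qed
  have copy: "(Copy f i, Copy g i) \<in> R" if "(f, g) \<in> R0" for f g
    using that unfolding R0_def
  proof (induction rule: rtrancl_induct)
    case base
    show ?case by (simp add: R_def)
  next
    case (step g h)
    then have "(Copy g i, Copy h i) \<in> R"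
      using over sym(1) by (auto simp: over_step_def dest: symD)
    with step.IH trans(1) show ?case by (meson transD)
  qed
  obtain a where a: "\<alpha> = R0 `` {a}"
    using assms(1) by (auto simp: arcs_def gen_classes_def R0_def elim: quotientE)
  have "R `` {Copy f i} = R `` {Copy e i}" if "f \<in> \<alpha>" for f
  proof -
    have "(f, e) \<in> R0"
      using that assms(2) sym(2) trans(2) unfolding a by (meson Image_singleton_iff symD transD)
    then have "(Copy f i, Copy e i) \<in> R" by (rule copy)
    then show ?thesis
      using sym(1) trans(1) by (blast dest: symD transD)
  qed
  then show ?thesis
    using assms(2) unfolding parallel_arc_def arc_of_def R_def[symmetric] by blast
qed

lemma parallel_arc_in_arcs:
  assumes \<alpha>: "\<alpha> \<in> arcs D" and i: "i \<in> {1..n}"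
  shows "parallel_arc n D \<alpha> i \<in> arcs (parallel n D)"
proof -
  obtain e where e: "e \<in> edges D" "e \<in> \<alpha>"
    using \<alpha> by (auto simp: arcs_def gen_classes_def elim!: quotientE)
  have "Copy e i \<in> edges (parallel n D)"
    using e i by (auto simp: parallel_def)
  then show ?thesis
    unfolding parallel_arc_eq[OF \<alpha> e(2) i] by (rule arc_of_in_arcs)
qed

end

theory Submission
  imports Defs
begin

text \<open>
  A coloring of the \<open>n\<close>-parallel puts a tuple \<open>v e\<close> of \<open>n\<close> colors on each edge \<open>e\<close> of the knot. The
  tuple does not change along an over strand. A strand of color \<open>b\<close> that passes below strands of the
  colors \<open>a 1, \<dots>, a n\<close> is reflected at each of them in turn and leaves with the color
  \<open>(-1) ^ n * b \<plusminus> 2 * \<Delta> a\<close>, where \<open>\<Delta> a\<close> is the alternating sum (\<open>under_passage_all\<close>). Conversely, tuples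
  that obey this rule at every crossing of the knot extend uniquely into the crossing regions
  (\<open>edge_coloring_of_strand_coloring\<close>, \<open>edge_coloring_parallel_eqI\<close>).

  The key point is that \<open>\<Delta> (v e)\<close> is the same for all edges (\<open>alternating_sum_constant_on_knot\<close>). For
  even \<open>n\<close> this is immediate. For odd \<open>n\<close> the numbers \<open>\<Delta> (v e)\<close> form a \<open>\<int>\<close>-coloring of the knot itself,
  and a knot has only constant ones, by a 2-adic descent (\<open>knot_edge_coloring_constant\<close>).

  With \<open>\<Delta>\<close> constant, an undercrossing of sign \<open>\<epsilon>\<close> acts on each copy by the translation by \<open>2 * \<epsilon> * \<Delta>\<close> for
  even \<open>n\<close>, and by the reflection \<open>b \<mapsto> 2 * \<Delta> - b\<close> for odd \<open>n\<close>. The tuple on one edge therefore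
  determines all others, which is injectivity. A tuple on one edge belongs to a coloring iff it comes
  back to itself after one tour around the knot. For even \<open>n\<close> the tour is the translation by \<open>2 * w * \<Delta>\<close>,
  so the condition is \<open>w * \<Delta> = 0\<close>. For odd \<open>n\<close> the number of reflections has the parity of \<open>w\<close>; if it is
  even, there is no condition, and if it is odd, all colors must equal \<open>\<Delta>\<close>, that is, the tuple is
  constant.
\<close>

section \<open>Colorings as functions of the edges\<close>

definition edge_coloring :: "('x, 'e) diagram \<Rightarrow> ('e \<Rightarrow> int) \<Rightarrow> bool" where
  "edge_coloring D c \<longleftrightarrow> (\<forall>x\<in>crossings D.
    c (edge_at D x Over Out) = c (edge_at D x Over In) \<and>
    2 * c (edge_at D x Over In) = c (edge_at D x Under In) + c (edge_at D x Under Out))"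

lemma arc_of_over_Out:
  assumes "x \<in> crossings D"
  shows "arc_of D (edge_at D x Over Out) = arc_of D (edge_at D x Over In)"
proof -
  let ?R = "over_step D \<union> converse (over_step D)"
  have "(edge_at D x Over In, edge_at D x Over Out) \<in> ?R\<^sup>*"
    "(edge_at D x Over Out, edge_at D x Over In) \<in> ?R\<^sup>*"
    using assms by (auto simp: over_step_def)
  then show ?thesis
    unfolding arc_of_def by (blast intro: rtrancl_trans)
qed

lemma edge_coloring_of_coloring:
  "C \<in> colorings D \<Longrightarrow> edge_coloring D (\<lambda>e. C (arc_of D e))"
  by (simp add: colorings_def edge_coloring_def arc_of_over_Out)

lemma edge_coloring_constant_on_arc:
  assumes "edge_coloring D c" and "f \<in> arc_of D e"
  shows "c f = c e"
proof -
  have "(e, f) \<in> (over_step D \<union> converse (over_step D))\<^sup>*"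
    using assms(2) by (simp add: arc_of_def)
  then show ?thesis
    by (induction rule: rtrancl_induct)
      (use assms(1) in \<open>auto simp: over_step_def edge_coloring_def\<close>)
qed

lemma arcs_eq: "arcs D = arc_of D ` edges D"
  by (auto simp: arcs_def gen_classes_def arc_of_def quotient_def)

lemma coloring_of_edge_coloring:
  assumes wf: "well_formed D" and c: "edge_coloring D c"
  obtains C where "C \<in> colorings D" and "\<And>e. e \<in> edges D \<Longrightarrow> C (arc_of D e) = c e"
proof -
  define C where "C = (\<lambda>\<alpha>\<in>arcs D. c (SOME e. e \<in> \<alpha>))"
  have C: "C (arc_of D e) = c e" if "e \<in> edges D" for e
  proof -
    have "e \<in> arc_of D e"
      by (simp add: arc_of_def)
    then have "(SOME f. f \<in> arc_of D e) \<in> arc_of D e"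
      by (rule someI)
    from edge_coloring_constant_on_arc[OF c this] show ?thesis
      using that by (simp add: C_def arc_of_in_arcs)
  qed
  have "edge_at D x s d \<in> edges D" if "x \<in> crossings D" for x s d
    using wf that by (simp add: well_formed_def)
  with c have "C \<in> colorings D"
    by (simp add: colorings_def C edge_coloring_def) (simp add: C_def)
  with C that show thesis by blast
qed

section \<open>Going once around a knot\<close>

text \<open>
  The components are the classes of the relation that joins the two edges of a strand at a crossing;
  since a knot has one class only, what passes through every crossing in both directions is true
  everywhere.
\<close>

lemma knot_induct [consumes 3, case_names base crossing]:
  assumes knot: "knot_diagram D" and e0: "e\<^sub>0 \<in> edges D" and e: "e \<in> edges D"
    and base: "P e\<^sub>0"
    and crossing: "\<And>x s. x \<in> crossings D \<Longrightarrow> P (edge_at D x s In) \<longleftrightarrow> P (edge_at D x s Out)"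
  shows "P e"
proof -
  define R where "R = {(edge_at D x s In, edge_at D x s Out) | x s. x \<in> crossings D}"
  have "card (edges D // (R \<union> converse R)\<^sup>*) = 1"
    using knot by (simp add: knot_diagram_def components_def gen_classes_def R_def)
  then have "(R \<union> converse R)\<^sup>* `` {e\<^sub>0} = (R \<union> converse R)\<^sup>* `` {e}"
    using quotientI[OF e0] quotientI[OF e] by (metis card_1_singletonE singletonD)
  then have "(e\<^sub>0, e) \<in> (R \<union> converse R)\<^sup>*"
    by auto
  then show ?thesis
  proof (induction rule: rtrancl_induct)
    case base
    show ?case by (fact assms(4))
  next
    case (step f g)
    then show ?case using crossing by (auto simp: R_def)
  qed
qed

text \<open>
  The successor of an edge along the orientation. The edges of a component without crossings are
  fixed, which makes the successor a permutation of all edges.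
\<close>

definition next_edge :: "('x, 'e) diagram \<Rightarrow> 'e \<Rightarrow> 'e" where
  "next_edge D e =
    (if \<exists>x\<in>crossings D. \<exists>s. e = edge_at D x s In
     then THE f. \<exists>x\<in>crossings D. \<exists>s. e = edge_at D x s In \<and> f = edge_at D x s Out
     else e)"

text \<open>
  The sign of the crossing that is passed below at the end of \<open>e\<close>, and \<open>0\<close> if there is none. The sum
  form makes the total over all edges the writhe by regrouping.
\<close>

definition under_sign :: "('x, 'e) diagram \<Rightarrow> 'e \<Rightarrow> int" where
  "under_sign D e = (\<Sum>x | x \<in> crossings D \<and> edge_at D x Under In = e. sign D x)"

lemma edge_at_inj:
  assumes "well_formed D" "x \<in> crossings D" "y \<in> crossings D" "edge_at D x s d = edge_at D y t d"
  shows "x = y \<and> s = t"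
proof -
  have "inj_on (\<lambda>(x, s). edge_at D x s d) (crossings D \<times> UNIV)"
    using assms(1) by (simp add: well_formed_def)
  from inj_onD[OF this, of "(x, s)" "(y, t)"] assms show ?thesis by simp
qed

lemma next_edge_In:
  assumes "well_formed D" "x \<in> crossings D"
  shows "next_edge D (edge_at D x s In) = edge_at D x s Out"
proof -
  have "(THE f. \<exists>y\<in>crossings D. \<exists>t. edge_at D x s In = edge_at D y t In \<and> f = edge_at D y t Out)
      = edge_at D x s Out"
    using assms by (blast dest: edge_at_inj)
  then show ?thesis
    using assms(2) by (auto simp: next_edge_def)
qed

lemma under_sign_Under:
  assumes "well_formed D" "x \<in> crossings D"
  shows "under_sign D (edge_at D x Under In) = sign D x"
proof -
  have "{y \<in> crossings D. edge_at D y Under In = edge_at D x Under In} = {x}"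
    using assms by (blast dest: edge_at_inj)
  then show ?thesis by (simp add: under_sign_def)
qed

lemma under_sign_Over:
  assumes "well_formed D" "x \<in> crossings D"
  shows "under_sign D (edge_at D x Over In) = 0"
proof -
  have "{y \<in> crossings D. edge_at D y Under In = edge_at D x Over In} = {}"
    using assms by (blast dest: edge_at_inj)
  then show ?thesis by (simp only: under_sign_def sum.empty)
qed

lemma sum_under_sign:
  assumes "well_formed D"
  shows "(\<Sum>e\<in>edges D. under_sign D e) = writhe D"
  unfolding under_sign_def writhe_def
  by (rule sum.group) (use assms in \<open>auto simp: well_formed_def\<close>)

lemma edge_cases [consumes 1]:
  assumes "well_formed D"
  obtains (Over) x where "x \<in> crossings D" "e = edge_at D x Over In"
      "next_edge D e = edge_at D x Over Out" "under_sign D e = 0"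
  | (Under) x where "x \<in> crossings D" "e = edge_at D x Under In"
      "next_edge D e = edge_at D x Under Out" "under_sign D e = sign D x"
  | (free) "next_edge D e = e" "under_sign D e = 0"
proof (cases "\<exists>x\<in>crossings D. \<exists>s. e = edge_at D x s In")
  case True
  then obtain x s where x: "x \<in> crossings D" "e = edge_at D x s In" by blast
  show thesis
  proof (cases s)
    case Over
    with x show thesis
      using assms by (intro that(1)) (auto simp: next_edge_In under_sign_Over)
  next
    case Under
    with x show thesis
      using assms by (intro that(2)) (auto simp: next_edge_In under_sign_Under)
  qed
next
  case False
  then have "{x \<in> crossings D. edge_at D x Under In = e} = {}"
    by blast
  then have "under_sign D e = 0"
    by (simp only: under_sign_def sum.empty)
  moreover have "next_edge D e = e"
    unfolding next_edge_def using False by (rule if_not_P)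
  ultimately show thesis by (intro that(3))
qed

lemma bij_next_edge:
  assumes wf: "well_formed D"
  shows "bij_betw (next_edge D) (edges D) (edges D)"
proof -
  have io: "{edge_at D x s In | x s. x \<in> crossings D} = {edge_at D x s Out | x s. x \<in> crossings D}"
    and fin: "finite (edges D)"
    and edge: "\<And>x s d. x \<in> crossings D \<Longrightarrow> edge_at D x s d \<in> edges D"
    using wf by (simp_all add: well_formed_def)
  have into: "next_edge D e \<in> edges D" if "e \<in> edges D" for e
    using wf that edge by (cases rule: edge_cases[where e = e]) auto
  have "f \<in> next_edge D ` edges D" if f: "f \<in> edges D" for f
  proof (cases "f \<in> {edge_at D x s Out | x s. x \<in> crossings D}")
    case True
    then obtain x s where "x \<in> crossings D" "f = edge_at D x s Out" by blast
    then show ?thesis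
      using next_edge_In[OF wf] edge by (metis imageI)
  next
    case False
    then have "f \<notin> {edge_at D x s In | x s. x \<in> crossings D}"
      using io by simp
    then have "next_edge D f = f"
      unfolding next_edge_def by (intro if_not_P) blast
    with f show ?thesis by (metis imageI)
  qed
  with into have img: "next_edge D ` edges D = edges D"
    by blast
  then show ?thesis
    using fin by (simp add: bij_betw_def eq_card_imp_inj_on)
qed

lemma bij_betw_periodic:
  assumes "bij_betw f A A" "finite A" "a \<in> A"
  shows "\<exists>k. (f ^^ k) (f a) = a"
proof -
  have in_A: "(f ^^ k) a \<in> A" for k
    using assms(1,3) by (induction k) (auto simp: bij_betw_def)
  \<comment> \<open>Two iterates coincide; cancelling the smaller number of steps leads back to \<open>a\<close>.\<close>
  have "\<not> inj (\<lambda>k. (f ^^ k) a)"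
    using in_A assms(2) by (meson finite_subset image_subsetI infinite_UNIV_nat finite_imageD)
  then obtain i j where "i < j" "(f ^^ i) a = (f ^^ j) a"
    unfolding inj_def by (metis linorder_neqE_nat)
  then show ?thesis
  proof (induction i arbitrary: j)
    case 0
    then obtain k where "j = Suc k" by (cases j) auto
    with 0 show ?case by (intro exI[of _ k]) (simp add: funpow_swap1)
  next
    case (Suc i)
    then obtain k where k: "j = Suc k" by (cases j) auto
    with Suc.prems have "f ((f ^^ i) a) = f ((f ^^ k) a)" by simp
    then have "(f ^^ i) a = (f ^^ k) a"
      using assms(1) in_A by (auto simp: bij_betw_def dest: inj_onD)
    with Suc.IH[of k] Suc.prems k show ?case by simp
  qed
qed

text \<open>
  Backwards steps, which connectedness also uses, are repeated forward steps, because a permutation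
  of a finite set is periodic.
\<close>

lemma next_edge_reaches:
  assumes knot: "knot_diagram D" and "e\<^sub>0 \<in> edges D" "e \<in> edges D"
  shows "\<exists>k. (next_edge D ^^ k) e = e\<^sub>0"
  using assms
proof (induction rule: knot_induct)
  case base
  show ?case by (rule exI[of _ 0]) simp
next
  case (crossing x s)
  have wf: "well_formed D"
    using knot by (simp add: knot_diagram_def link_diagram_def)
  let ?e = "edge_at D x s In" and ?f = "edge_at D x s Out"
  have f: "next_edge D ?e = ?f"
    using wf crossing by (rule next_edge_In)
  show ?case
  proof
    assume "\<exists>k. (next_edge D ^^ k) ?f = e\<^sub>0"
    then obtain k where "(next_edge D ^^ k) ?f = e\<^sub>0" ..
    then show "\<exists>k. (next_edge D ^^ k) ?e = e\<^sub>0"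
      by (intro exI[of _ "Suc k"]) (simp add: funpow_swap1 f)
  next
    assume "\<exists>k. (next_edge D ^^ k) ?e = e\<^sub>0"
    then obtain k where k: "(next_edge D ^^ k) ?e = e\<^sub>0" ..
    show "\<exists>k. (next_edge D ^^ k) ?f = e\<^sub>0"
    proof (cases k)
      case 0
      with k show ?thesis
        using bij_betw_periodic[OF bij_next_edge[OF wf] _ assms(2)] wf f
        by (simp add: well_formed_def)
    next
      case (Suc m)
      with k show ?thesis
        by (intro exI[of _ m]) (simp add: funpow_swap1 f)
    qed
  qed
qed

text \<open>
  The potential \<open>h\<close> counts the undercrossings with their signs along the way from \<open>e\<^sub>0\<close>; the whole
  tour counts the writhe, so \<open>h\<close> jumps back by it on leaving \<open>e\<^sub>0\<close>. It is this jump that decides which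
  colors on \<open>e\<^sub>0\<close> can be continued around the knot.
\<close>

lemma knot_potential:
  assumes knot: "knot_diagram D" and e0: "e\<^sub>0 \<in> edges D"
  obtains h :: "'e \<Rightarrow> int" where "h e\<^sub>0 = 0"
    "\<And>e. e \<in> edges D \<Longrightarrow>
      h (next_edge D e) = h e + under_sign D e - (if e = e\<^sub>0 then writhe D else 0)"
proof -
  have wf: "well_formed D"
    using knot by (simp add: knot_diagram_def link_diagram_def)
  then have fin: "finite (edges D)"
    by (simp add: well_formed_def)
  define f where "f = next_edge D"
  define g where "g = under_sign D"
  \<comment> \<open>The distance is measured forwards, from \<open>e\<close> to \<open>e\<^sub>0\<close>, so that a step lowers it by one except at \<open>e\<^sub>0\<close>.\<close>
  define dist where "dist e = (LEAST k. (f ^^ k) e = e\<^sub>0)" for e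
  define h where "h e = - (\<Sum>k<dist e. g ((f ^^ k) e))" for e
  have step: "h (f e) = h e + g e" if e: "e \<in> edges D" "e \<noteq> e\<^sub>0" for e
  proof -
    obtain k where "(f ^^ k) e = e\<^sub>0"
      using next_edge_reaches[OF knot e0 e(1)] unfolding f_def by blast
    then have "dist e = Suc (LEAST k. (f ^^ Suc k) e = e\<^sub>0)"
      unfolding dist_def by (rule Least_Suc) (use e in simp)
    also have "\<dots> = Suc (dist (f e))"
      by (simp add: dist_def funpow_swap1)
    finally have "dist e = Suc (dist (f e))" .
    then show ?thesis
      by (simp add: h_def sum.lessThan_Suc_shift funpow_swap1 del: sum.lessThan_Suc)
  qed
  have "dist e\<^sub>0 = 0"
    unfolding dist_def by (rule Least_eq_0) simp
  then have h0: "h e\<^sub>0 = 0"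
    by (simp add: h_def)
  \<comment> \<open>The jump at \<open>e\<^sub>0\<close> is computed from the others: all changes of \<open>h\<close> add up to zero.\<close>
  have "(\<Sum>e\<in>edges D. h (f e)) = (\<Sum>e\<in>edges D. h e)"
    unfolding f_def by (rule sum.reindex_bij_betw[OF bij_next_edge[OF wf]])
  then have "(\<Sum>e\<in>edges D. h (f e) - h e - g e) = - writhe D"
    using sum_under_sign[OF wf] by (simp add: sum_subtractf g_def)
  moreover have "(\<Sum>e\<in>edges D. h (f e) - h e - g e) = h (f e\<^sub>0) - h e\<^sub>0 - g e\<^sub>0"
    using step by (subst sum.remove[OF fin e0]) simp
  ultimately have "h (f e\<^sub>0) = h e\<^sub>0 + g e\<^sub>0 - writhe D"
    by simp
  with step h0 that[of h] show thesis
    by (auto simp: f_def g_def)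
qed

section \<open>Integer colorings of a knot\<close>

text \<open>
  A knot has only trivial \<open>\<int>\<close>-colorings. At an undercrossing the differences \<open>c e - c e\<^sub>0\<close> of the two
  under edges add up to twice that of the over edge. If \<open>2 ^ k\<close> divides all differences, then
  \<open>2 ^ (k + 1)\<close> divides this sum, hence divides one of its summands iff it divides the other; the
  trivial difference at \<open>e\<^sub>0\<close> then spreads divisibility by \<open>2 ^ (k + 1)\<close> over the knot. So every
  difference is divisible by all powers of two. This replaces the classical argument that the
  determinant of a knot is odd.
\<close>

lemma knot_edge_coloring_constant:
  assumes knot: "knot_diagram D" and c: "edge_coloring D c"
    and e0: "e\<^sub>0 \<in> edges D" and e: "e \<in> edges D"
  shows "c e = c e\<^sub>0"
proof -
  have edge: "\<And>x s d. x \<in> crossings D \<Longrightarrow> edge_at D x s d \<in> edges D"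
    using knot by (simp add: knot_diagram_def link_diagram_def well_formed_def)
  have dvd: "\<forall>e\<in>edges D. 2 ^ k dvd c e - c e\<^sub>0" for k
  proof (induction k)
    case (Suc k)
    show ?case
    proof
      fix e assume "e \<in> edges D"
      with knot e0 show "2 ^ Suc k dvd c e - c e\<^sub>0"
      proof (induction rule: knot_induct)
        case (crossing x s)
        show ?case
        proof (cases s)
          case Over
          with c crossing show ?thesis by (simp add: edge_coloring_def)
        next
          case Under
          have "2 ^ k dvd c (edge_at D x Over In) - c e\<^sub>0"
            using Suc edge[OF crossing] by blast
          then have "2 ^ Suc k dvd 2 * (c (edge_at D x Over In) - c e\<^sub>0)"
            unfolding power_Suc by (rule mult_dvd_mono[OF dvd_refl])
          also have "2 * (c (edge_at D x Over In) - c e\<^sub>0)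
              = (c (edge_at D x Under In) - c e\<^sub>0) + (c (edge_at D x Under Out) - c e\<^sub>0)"
            using c crossing by (simp add: edge_coloring_def)
          finally show ?thesis
            unfolding Under by (metis dvd_add_right_iff dvd_add_left_iff)
        qed
      qed simp
    qed
  qed simp
  show ?thesis
  proof (rule ccontr)
    assume "c e \<noteq> c e\<^sub>0"
    define m where "m = nat \<bar>c e - c e\<^sub>0\<bar>"
    have "2 ^ m dvd c e - c e\<^sub>0"
      using dvd e by blast
    with \<open>c e \<noteq> c e\<^sub>0\<close> have "2 ^ m \<le> \<bar>c e - c e\<^sub>0\<bar>"
      by (metis abs_numeral dvd_imp_le_int eq_iff_diff_eq_0 power_abs)
    also have "\<dots> = int m"
      by (simp add: m_def)
    also have "\<dots> < 2 ^ m"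
      by (metis less_exp of_nat_less_numeral_power_cancel_iff)
    finally show False by simp
  qed
qed

section \<open>Passing below parallel strands\<close>

definition alternating_sum :: "nat \<Rightarrow> (nat \<Rightarrow> int) \<Rightarrow> int" where
  "alternating_sum n a = (\<Sum>i=1..n. (-1) ^ (i + 1) * a i)"

text \<open>
  The color of a strand that starts with color \<open>b\<close>, after it has passed below \<open>p\<close> strands with the
  colors \<open>a 1, \<dots>, a p\<close> in this order
\<close>

primrec under_passage :: "(nat \<Rightarrow> int) \<Rightarrow> int \<Rightarrow> nat \<Rightarrow> int" where
  "under_passage a b 0 = b"
| "under_passage a b (Suc p) = 2 * a (Suc p) - under_passage a b p"

lemma under_passage_eq:
  "under_passage a b p = (-1) ^ p * b + 2 * (\<Sum>q=1..p. (-1) ^ (p - q) * a q)"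
proof (induction p)
  case (Suc p)
  have "(\<Sum>q=1..p. (-1) ^ (Suc p - q) * a q) = - (\<Sum>q=1..p. (-1) ^ (p - q) * a q)"
    unfolding sum_negf[symmetric] by (rule sum.cong) (auto simp: Suc_diff_le)
  with Suc show ?case by simp
qed simp

lemma alternating_sum_rev:
  "alternating_sum n (\<lambda>i. a (n + 1 - i)) = (-1) ^ (n + 1) * alternating_sum n a"
proof -
  have "alternating_sum n (\<lambda>i. a (n + 1 - i)) = (\<Sum>i=1..n. (-1) ^ (n + 1 - i + 1) * a i)"
    unfolding alternating_sum_def by (subst sum.atLeastAtMost_rev) simp
  also have "\<dots> = (\<Sum>i=1..n. (-1) ^ (n + 1) * ((-1) ^ (i + 1) * a i))"
    by (rule sum.cong) (auto simp: minus_one_power_iff)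
  finally show ?thesis
    by (simp add: alternating_sum_def sum_distrib_left)
qed

text \<open>
  All copies of an under strand are changed by the same rule, in which the over strand enters only
  through its alternating sum. The two signs of a crossing differ in the order in which the over
  copies are met, and reversing the order multiplies the alternating sum by \<open>(-1) ^ (n + 1)\<close>.
\<close>

lemma under_passage_all:
  assumes "\<epsilon> \<in> {1, -1}"
  shows "under_passage (\<lambda>q. a (meet_pos n \<epsilon> Under q)) b n
    = (-1) ^ n * b + 2 * (if \<epsilon> = 1 then 1 else (-1) ^ (n + 1)) * alternating_sum n a"
proof -
  have "(\<Sum>q=1..n. (-1) ^ (n - q) * a' q) = (-1) ^ (n + 1) * alternating_sum n a'"
    for a' :: "nat \<Rightarrow> int"
    unfolding alternating_sum_def sum_distrib_left
    by (rule sum.cong) (auto simp: minus_one_power_iff)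
  then show ?thesis
    using assms alternating_sum_rev[of n a]
    by (auto simp: under_passage_eq meet_pos_def simp flip: power_add mult.assoc mult_2)
qed

section \<open>Colorings of the parallel as families of colors on the knot\<close>

text \<open>
  The conditions that a coloring of the \<open>n\<close>-parallel imposes on the colors \<open>v e i\<close> of the copies of
  the edges, once the colors inside the crossing regions are eliminated
\<close>

definition strand_coloring :: "nat \<Rightarrow> ('x, 'e) diagram \<Rightarrow> ('e \<Rightarrow> nat \<Rightarrow> int) \<Rightarrow> bool" where
  "strand_coloring n D v \<longleftrightarrow> (\<forall>x\<in>crossings D. \<forall>i\<in>{1..n}.
    v (edge_at D x Over Out) i = v (edge_at D x Over In) i \<and>
    v (edge_at D x Under Out) i = (-1) ^ n * v (edge_at D x Under In) i
      + 2 * (if sign D x = 1 then 1 else (-1) ^ (n + 1))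
        * alternating_sum n (v (edge_at D x Over In)))"

lemma edge_coloring_parallel_over:
  assumes c: "edge_coloring (parallel n D) c" and x: "x \<in> crossings D"
    and i: "i \<in> {1..n}" and p: "p \<in> {1..n}"
  shows "c (edge_at (parallel n D) (nth_crossing n D x Over i p) Over d)
    = c (Copy (edge_at D x Over In) i)"
proof -
  let ?e = "\<lambda>p d. edge_at (parallel n D) (nth_crossing n D x Over i p) Over d"
  have over: "c (?e p Out) = c (?e p In)" if "p \<in> {1..n}" for p
    using c nth_crossing_in[OF x i that] by (simp add: edge_coloring_def)
  have "c (?e p In) = c (Copy (edge_at D x Over In) i)"
    using p
  proof (induction p)
    case (Suc p)
    show ?case
    proof (cases "p = 0")
      case True
      with Suc.prems i show ?thesis by (simp add: edge_at_nth_crossing)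
    next
      case False
      then have "c (?e (Suc p) In) = c (?e p Out)"
        using Suc.prems i by (simp add: edge_at_nth_crossing)
      with False Suc over show ?thesis by simp
    qed
  qed simp
  with over[OF p] show ?thesis by (cases d) simp_all
qed

lemma nth_crossing_Under_eq_Over:
  assumes "j \<in> {1..n}" "p \<in> {1..n}"
  shows "nth_crossing n D x Under j p
    = nth_crossing n D x Over (meet_pos n (sign D x) Under p) (meet_pos n (sign D x) Over j)"
  using assms by (auto simp: nth_crossing_def meet_pos_def)

lemma meet_pos_in: "p \<in> {1..n} \<Longrightarrow> meet_pos n \<epsilon> s p \<in> {1..n}"
  by (auto simp: meet_pos_def)

lemma edge_coloring_parallel_under:
  assumes c: "edge_coloring (parallel n D) c" and x: "x \<in> crossings D"
    and j: "j \<in> {1..n}" and p: "p \<in> {1..n}"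
  shows "c (edge_at (parallel n D) (nth_crossing n D x Under j p) Under Out)
    = under_passage (\<lambda>q. c (Copy (edge_at D x Over In) (meet_pos n (sign D x) Under q)))
        (c (Copy (edge_at D x Under In) j)) p"
  using p
proof (induction p)
  case (Suc p)
  let ?P = "parallel n D" and ?y = "nth_crossing n D x Under j"
  let ?k = "meet_pos n (sign D x) Under (Suc p)"
  have "2 * c (edge_at ?P (?y (Suc p)) Over In)
      = c (edge_at ?P (?y (Suc p)) Under In) + c (edge_at ?P (?y (Suc p)) Under Out)"
    using c nth_crossing_in[OF x j Suc.prems] by (simp add: edge_coloring_def)
  moreover have "c (edge_at ?P (?y (Suc p)) Over In) = c (Copy (edge_at D x Over In) ?k)"
    unfolding nth_crossing_Under_eq_Over[OF j Suc.prems]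
    using j Suc.prems by (intro edge_coloring_parallel_over[OF c x] meet_pos_in)
  moreover have "c (edge_at ?P (?y (Suc p)) Under In)
      = under_passage (\<lambda>q. c (Copy (edge_at D x Over In) (meet_pos n (sign D x) Under q)))
          (c (Copy (edge_at D x Under In) j)) p"
  proof (cases "p = 0")
    case True
    with j Suc.prems show ?thesis by (simp add: edge_at_nth_crossing)
  next
    case False
    then have "edge_at ?P (?y (Suc p)) Under In = edge_at ?P (?y p) Under Out"
      using Suc.prems j by (simp add: edge_at_nth_crossing)
    with Suc False show ?thesis by simp
  qed
  ultimately show ?case by simp
qed simp

lemma strand_coloring_of_edge_coloring:
  assumes wf: "well_formed D" and n: "n \<ge> 1" and c: "edge_coloring (parallel n D) c"
  shows "strand_coloring n D (\<lambda>e i. c (Copy e i))"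
  unfolding strand_coloring_def
proof (intro ballI conjI)
  fix x i assume x: "x \<in> crossings D" and i: "i \<in> {1..n}"
  have n': "n \<in> {1..n}" and eps: "sign D x \<in> {1, -1}"
    using n wf x by (simp_all add: well_formed_def)
  have copy: "Copy (edge_at D x s Out) i
      = edge_at (parallel n D) (nth_crossing n D x s i n) s Out" for s
    using i n' by (simp add: edge_at_nth_crossing)
  show "c (Copy (edge_at D x Over Out) i) = c (Copy (edge_at D x Over In) i)"
    unfolding copy by (rule edge_coloring_parallel_over[OF c x i n'])
  show "c (Copy (edge_at D x Under Out) i) = (-1) ^ n * c (Copy (edge_at D x Under In) i)
      + 2 * (if sign D x = 1 then 1 else (-1) ^ (n + 1))
        * alternating_sum n (\<lambda>i. c (Copy (edge_at D x Over In) i))"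
    unfolding copy edge_coloring_parallel_under[OF c x i n']
    by (rule under_passage_all[OF eps])
qed

text \<open>
  The colors inside a crossing region are forced: they are constant on the over copies and follow
  \<open>under_passage\<close> on the under copies. The condition on \<open>v\<close> says that the last color of the passage
  is the one prescribed outside.
\<close>

lemma edge_coloring_of_strand_coloring:
  assumes wf: "well_formed D" and n: "n \<ge> 1" and v: "strand_coloring n D v"
  obtains c where "edge_coloring (parallel n D) c" and "\<And>e i. c (Copy e i) = v e i"
proof -
  let ?P = "parallel n D"
  define pass where "pass x = under_passage
      (\<lambda>q. v (edge_at D x Over In) (meet_pos n (sign D x) Under q))" for x
  define c where "c f = (case f of Copy e i \<Rightarrow> v e i
    | Inner x s i p \<Rightarrow> (case s of Over \<Rightarrow> v (edge_at D x Over In) i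
        | Under \<Rightarrow> pass x (v (edge_at D x Under In) i) p))" for f
  have over: "c (edge_at ?P (nth_crossing n D x Over i p) Over d) = v (edge_at D x Over In) i"
    if "x \<in> crossings D" "i \<in> {1..n}" "p \<in> {1..n}" for x i p d
    unfolding edge_at_nth_crossing[OF that(2,3)]
    using v that by (auto simp: c_def strand_coloring_def split: dir.split)
  have under: "c (edge_at ?P (nth_crossing n D x Under j p) Under d)
      = pass x (v (edge_at D x Under In) j) (case d of In \<Rightarrow> p - 1 | Out \<Rightarrow> p)"
    if x: "x \<in> crossings D" and j: "j \<in> {1..n}" and p: "p \<in> {1..n}" for x j p d
  proof -
    have "sign D x \<in> {1, -1}"
      using wf x by (simp add: well_formed_def)
    then have "v (edge_at D x Under Out) j = pass x (v (edge_at D x Under In) j) n"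
      using v x j by (simp only: strand_coloring_def pass_def under_passage_all)
    then show ?thesis
      unfolding edge_at_nth_crossing[OF j p] using p
      by (auto simp: c_def pass_def split: dir.split)
  qed
  have "edge_coloring ?P c"
    unfolding edge_coloring_def
  proof (intro ballI)
    fix y assume "y \<in> crossings ?P"
    then obtain x j p where x: "x \<in> crossings D" and j: "j \<in> {1..n}" and p: "p \<in> {1..n}"
      and y: "y = nth_crossing n D x Under j p"
      by (rule nth_crossing_cases)
    let ?k = "meet_pos n (sign D x) Under p"
    have "c (edge_at ?P y Over d) = v (edge_at D x Over In) ?k" for d
      unfolding y nth_crossing_Under_eq_Over[OF j p]
      using x j p by (intro over meet_pos_in)
    moreover have "c (edge_at ?P y Under In) + c (edge_at ?P y Under Out)
        = 2 * v (edge_at D x Over In) ?k"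
      unfolding y under[OF x j p] using p by (cases p) (simp_all add: pass_def)
    ultimately show "c (edge_at ?P y Over Out) = c (edge_at ?P y Over In) \<and>
        2 * c (edge_at ?P y Over In) = c (edge_at ?P y Under In) + c (edge_at ?P y Under Out)"
      by simp
  qed
  with that[of c] show thesis
    by (simp add: c_def)
qed

lemma edge_coloring_parallel_eqI:
  assumes c: "edge_coloring (parallel n D) c" and c': "edge_coloring (parallel n D) c'"
    and wf: "well_formed D"
    and eq: "\<And>e i. e \<in> edges D \<Longrightarrow> i \<in> {1..n} \<Longrightarrow> c (Copy e i) = c' (Copy e i)"
    and f: "f \<in> edges (parallel n D)"
  shows "c f = c' f"
proof -
  have "c (Inner x s i p) = c' (Inner x s i p)"
    if x: "x \<in> crossings D" and i: "i \<in> {1..n}" and p: "p \<in> {1..<n}" for x s i p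
  proof -
    have edge: "\<And>s d. edge_at D x s d \<in> edges D"
      using wf x by (simp add: well_formed_def)
    have p': "p \<in> {1..n}"
      using p by simp
    have inner: "Inner x s i p = edge_at (parallel n D) (nth_crossing n D x s i p) s Out"
      using i p by (simp add: edge_at_nth_crossing)
    show ?thesis
    proof (cases s)
      case Over
      show ?thesis
        unfolding inner unfolding Over
        using edge_coloring_parallel_over[OF c x i p'] edge_coloring_parallel_over[OF c' x i p']
          eq[OF edge i] by simp
    next
      case Under
      have "under_passage (\<lambda>q. c (Copy (edge_at D x Over In) (meet_pos n (sign D x) Under q))) b q
        = under_passage (\<lambda>q. c' (Copy (edge_at D x Over In) (meet_pos n (sign D x) Under q))) b q"
        if "q \<le> n" for b q
        using that
      proof (induction q)
        case (Suc q)
        then have "Suc q \<in> {1..n}" by simp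
        with Suc eq[OF edge meet_pos_in] show ?case by simp
      qed simp
      then show ?thesis
        unfolding inner unfolding Under
        using edge_coloring_parallel_under[OF c x i p'] edge_coloring_parallel_under[OF c' x i p']
          eq[OF edge i] p' by simp
    qed
  qed
  with eq f show ?thesis
    by (auto simp: parallel_def)
qed

lemma alternating_sum_affine:
  "alternating_sum n (\<lambda>i. k * a i + b) = k * alternating_sum n a + (if even n then 0 else b)"
proof (induction n)
  case (Suc n)
  then show ?case
    by (auto simp: alternating_sum_def algebra_simps)
qed (simp add: alternating_sum_def)

lemma alternating_sum_cong:
  "(\<And>i. i \<in> {1..n} \<Longrightarrow> a i = b i) \<Longrightarrow> alternating_sum n a = alternating_sum n b"
  unfolding alternating_sum_def by (rule sum.cong) auto

section \<open>The alternating sum is an invariant\<close>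

text \<open>
  For even \<open>n\<close>, an undercrossing adds one number to all copies, and the alternating sum of a constant
  tuple vanishes. For odd \<open>n\<close>, an undercrossing reflects every copy at the alternating sum of the over
  strand, so that the alternating sums themselves form a \<open>\<int>\<close>-coloring of the knot.
\<close>

lemma alternating_sum_constant_on_knot:
  assumes knot: "knot_diagram D" and v: "strand_coloring n D v"
    and e0: "e\<^sub>0 \<in> edges D" and e: "e \<in> edges D"
  shows "alternating_sum n (v e) = alternating_sum n (v e\<^sub>0)"
proof -
  have over: "alternating_sum n (v (edge_at D x Over Out))
      = alternating_sum n (v (edge_at D x Over In))"
    if "x \<in> crossings D" for x
    using v that by (intro alternating_sum_cong) (simp add: strand_coloring_def)
  have under: "alternating_sum n (v (edge_at D x Under Out))
      = (-1) ^ n * alternating_sum n (v (edge_at D x Under In))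
        + (if even n then 0 else 2 * alternating_sum n (v (edge_at D x Over In)))"
    if x: "x \<in> crossings D" for x
  proof -
    have "alternating_sum n (v (edge_at D x Under Out))
        = alternating_sum n (\<lambda>i. (-1) ^ n * v (edge_at D x Under In) i
            + 2 * (if sign D x = 1 then 1 else (-1) ^ (n + 1))
              * alternating_sum n (v (edge_at D x Over In)))"
      using v x by (intro alternating_sum_cong) (simp add: strand_coloring_def)
    then show ?thesis
      unfolding alternating_sum_affine by simp
  qed
  show ?thesis
  proof (cases "even n")
    case True
    from knot e0 e show ?thesis
    proof (induction rule: knot_induct)
      case (crossing x s)
      with over under True show ?case by (cases s) simp_all
    qed simp
  next
    case False
    then have "edge_coloring D (\<lambda>e. alternating_sum n (v e))"
      using over under by (simp add: edge_coloring_def)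
    from knot_edge_coloring_constant[OF knot this e0 e] show ?thesis .
  qed
qed

text \<open>
  Since the alternating sum is a constant \<open>\<Delta>\<close>, the crossings no longer interact: an undercrossing is
  the translation by \<open>\<plusminus> 2 \<Delta>\<close> for even \<open>n\<close>, and the reflection at \<open>\<Delta>\<close> for odd \<open>n\<close>.
\<close>

lemma strand_coloring_next_edge:
  assumes knot: "knot_diagram D" and v: "strand_coloring n D v"
    and e0: "e\<^sub>0 \<in> edges D" and i: "i \<in> {1..n}"
  shows "v (next_edge D e) i =
    (if even n then v e i + 2 * under_sign D e * alternating_sum n (v e\<^sub>0)
     else if even (under_sign D e) then v e i
     else 2 * alternating_sum n (v e\<^sub>0) - v e i)"
proof -
  have wf: "well_formed D"
    using knot by (simp add: knot_diagram_def link_diagram_def)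
  from wf show ?thesis
  proof (cases rule: edge_cases[where e = e])
    case (Over x)
    with v i show ?thesis by (simp add: strand_coloring_def)
  next
    case (Under x)
    then have "edge_at D x Over In \<in> edges D" "sign D x \<in> {1, -1}"
      using wf by (simp_all add: well_formed_def)
    moreover from this have "alternating_sum n (v (edge_at D x Over In)) = alternating_sum n (v e\<^sub>0)"
      by (intro alternating_sum_constant_on_knot[OF knot v e0])
    ultimately show ?thesis
      using v i Under by (auto simp: strand_coloring_def)
  qed simp
qed

lemma strand_coloring_unique:
  assumes knot: "knot_diagram D" and v: "strand_coloring n D v" and v': "strand_coloring n D v'"
    and e0: "e\<^sub>0 \<in> edges D" and e: "e \<in> edges D"
    and eq: "\<And>i. i \<in> {1..n} \<Longrightarrow> v e\<^sub>0 i = v' e\<^sub>0 i" and i: "i \<in> {1..n}"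
  shows "v e i = v' e i"
  using knot e0 e
proof (induction rule: knot_induct)
  case base
  show ?case by (rule eq[OF i])
next
  case (crossing x s)
  have wf: "well_formed D"
    using knot by (simp add: knot_diagram_def link_diagram_def)
  have "alternating_sum n (v e\<^sub>0) = alternating_sum n (v' e\<^sub>0)"
    by (rule alternating_sum_cong[OF eq])
  with strand_coloring_next_edge[OF knot v e0 i, of "edge_at D x s In"]
    strand_coloring_next_edge[OF knot v' e0 i, of "edge_at D x s In"]
  show ?case
    unfolding next_edge_In[OF wf crossing] by (auto split: if_splits)
qed

section \<open>Colors that close up around the knot\<close>

text \<open>
  The condition for colors \<open>a\<close> to return to themselves after one tour around a knot of writhe \<open>w\<close>
\<close>

definition closing_condition :: "nat \<Rightarrow> int \<Rightarrow> (nat \<Rightarrow> int) \<Rightarrow> bool" where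
  "closing_condition n w a \<longleftrightarrow>
    (if even n then w * alternating_sum n a = 0
     else odd w \<longrightarrow> (\<exists>c. \<forall>i\<in>{1..n}. a i = c))"

lemma prod_parity_sign:
  fixes g :: "'a \<Rightarrow> int"
  shows "finite A \<Longrightarrow> (\<Prod>e\<in>A. if even (g e) then 1 else -1 :: int)
    = (if even (\<Sum>e\<in>A. g e) then 1 else -1)"
  by (induction rule: finite_induct) auto

text \<open>
  The successor permutes the edges, so a sum or a product over all edges does not change when it is
  shifted by one step. For even \<open>n\<close>, shifting the sum of the first copies adds \<open>2 w \<Delta>\<close>. For odd \<open>n\<close>,
  the deviations from \<open>\<Delta>\<close> change their sign at each undercrossing, so shifting their product changes
  its sign if \<open>w\<close> is odd; then some deviation vanishes, and with it all.
\<close>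

lemma strand_coloring_closes_up:
  assumes knot: "knot_diagram D" and v: "strand_coloring n D v" and e0: "e\<^sub>0 \<in> edges D"
    and n: "n \<ge> 1"
  shows "closing_condition n (writhe D) (v e\<^sub>0)"
proof -
  have wf: "well_formed D"
    using knot by (simp add: knot_diagram_def link_diagram_def)
  then have fin: "finite (edges D)"
    by (simp add: well_formed_def)
  let ?f = "next_edge D" and ?g = "under_sign D" and ?\<Delta> = "alternating_sum n (v e\<^sub>0)"
  have step: "v (?f e) i = (if even n then v e i + 2 * ?g e * ?\<Delta>
      else if even (?g e) then v e i else 2 * ?\<Delta> - v e i)" if "i \<in> {1..n}" for e i
    by (rule strand_coloring_next_edge[OF knot v e0 that])
  show ?thesis
  proof (cases "even n")
    case True
    have "(\<Sum>e\<in>edges D. v (?f e) 1) = (\<Sum>e\<in>edges D. v e 1)"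
      by (rule sum.reindex_bij_betw[OF bij_next_edge[OF wf]])
    moreover have "(\<Sum>e\<in>edges D. v (?f e) 1) = (\<Sum>e\<in>edges D. v e 1) + 2 * writhe D * ?\<Delta>"
      using step[of 1] True n
      by (simp add: sum.distrib sum_under_sign[OF wf, symmetric] sum_distrib_left sum_distrib_right)
    ultimately show ?thesis
      using True by (simp add: closing_condition_def)
  next
    case False
    have "v e\<^sub>0 i = ?\<Delta>" if w: "odd (writhe D)" and i: "i \<in> {1..n}" for i
    proof -
      define u where "u e = v e i - ?\<Delta>" for e
      have u: "u (?f e) = (if even (?g e) then 1 else -1) * u e" for e
        using step[OF i] False by (simp add: u_def)
      have "(\<Prod>e\<in>edges D. u e) = (\<Prod>e\<in>edges D. u (?f e))"
        by (rule prod.reindex_bij_betw[OF bij_next_edge[OF wf], symmetric])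
      also have "\<dots> = - (\<Prod>e\<in>edges D. u e)"
        unfolding u prod.distrib prod_parity_sign[OF fin] sum_under_sign[OF wf] using w by simp
      finally obtain e where e: "e \<in> edges D" "u e = 0"
        using fin by auto
      from knot e(1) e0 have "u e\<^sub>0 = 0"
      proof (induction rule: knot_induct)
        case base
        show ?case by (fact e(2))
      next
        case (crossing x s)
        with u[of "edge_at D x s In"] show ?case
          by (simp add: next_edge_In[OF wf] split: if_splits)
      qed
      then show ?thesis by (simp add: u_def)
    qed
    with False show ?thesis
      by (auto simp: closing_condition_def)
  qed
qed

text \<open>
  The converse of \<open>strand_coloring_next_edge\<close>: when the alternating sum is a constant \<open>\<Delta>\<close>, it is enough
  to follow the knot edge by edge.
\<close>

lemma strand_coloringI:
  assumes wf: "well_formed D"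
    and alt: "\<And>e. e \<in> edges D \<Longrightarrow> alternating_sum n (v e) = \<Delta>"
    and step: "\<And>e i. e \<in> edges D \<Longrightarrow> i \<in> {1..n} \<Longrightarrow> v (next_edge D e) i =
      (if even n then v e i + 2 * under_sign D e * \<Delta>
       else if even (under_sign D e) then v e i else 2 * \<Delta> - v e i)"
  shows "strand_coloring n D v"
  unfolding strand_coloring_def
proof (intro ballI)
  fix x i assume x: "x \<in> crossings D" and i: "i \<in> {1..n}"
  have edge: "\<And>s d. edge_at D x s d \<in> edges D" and eps: "sign D x \<in> {1, -1}"
    using wf x by (simp_all add: well_formed_def)
  from step[OF edge i, of Over In] step[OF edge i, of Under In] eps
  show "v (edge_at D x Over Out) i = v (edge_at D x Over In) i \<and>
    v (edge_at D x Under Out) i = (-1) ^ n * v (edge_at D x Under In) i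
      + 2 * (if sign D x = 1 then 1 else (-1) ^ (n + 1))
        * alternating_sum n (v (edge_at D x Over In))"
    by (auto simp: next_edge_In[OF wf x] under_sign_Over[OF wf x] under_sign_Under[OF wf x]
        alt[OF edge])
qed

text \<open>
  Translating the given tuple by \<open>2 \<Delta> h\<close>, or reflecting it \<open>h\<close> times at \<open>\<Delta>\<close>, for the potential \<open>h\<close> of
  \<open>knot_potential\<close>, gives the right change at each crossing. The closing condition makes the jump of \<open>h\<close>
  by the writhe harmless; for odd \<open>n\<close> and odd writhe it does so by forcing a constant tuple, which is
  its own reflection.
\<close>

lemma strand_coloring_exists:
  assumes knot: "knot_diagram D" and e0: "e\<^sub>0 \<in> edges D"
    and a: "closing_condition n (writhe D) a"
  obtains v where "strand_coloring n D v" and "\<And>i. i \<in> {1..n} \<Longrightarrow> v e\<^sub>0 i = a i"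
proof -
  have wf: "well_formed D"
    using knot by (simp add: knot_diagram_def link_diagram_def)
  let ?\<Delta> = "alternating_sum n a"
  obtain h where h0: "h e\<^sub>0 = 0" and h: "\<And>e. e \<in> edges D \<Longrightarrow>
      h (next_edge D e) = h e + under_sign D e - (if e = e\<^sub>0 then writhe D else 0)"
    using knot_potential[OF knot e0] by blast
  show thesis
  proof (cases "even n")
    case True
    \<comment> \<open>The factor \<open>1\<close> gives the form to which \<open>alternating_sum_affine\<close> applies.\<close>
    define v where "v e i = 1 * a i + 2 * ?\<Delta> * h e" for e i
    have w: "writhe D * ?\<Delta> = 0"
      using a True by (simp add: closing_condition_def)
    have "strand_coloring n D v"
    proof (rule strand_coloringI[OF wf])
      show "alternating_sum n (v e) = ?\<Delta>" for e
        unfolding v_def alternating_sum_affine using True by simp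
      show "v (next_edge D e) i = (if even n then v e i + 2 * under_sign D e * ?\<Delta>
          else if even (under_sign D e) then v e i else 2 * ?\<Delta> - v e i)"
        if "e \<in> edges D" for e i
      proof -
        have "?\<Delta> * h (next_edge D e) = ?\<Delta> * (h e + under_sign D e)"
          unfolding h[OF that] using w by (auto simp: algebra_simps)
        with True show ?thesis by (simp add: v_def algebra_simps)
      qed
    qed
    then show thesis by (rule that) (simp add: v_def h0)
  next
    case False
    show thesis
    proof (cases "even (writhe D)")
      case w: True
      define v where "v e i = (if even (h e) then 1 else -1) * a i
          + (if even (h e) then 0 else 2 * ?\<Delta>)" for e i
      have "strand_coloring n D v"
      proof (rule strand_coloringI[OF wf])
        show "alternating_sum n (v e) = ?\<Delta>" for e
          unfolding v_def alternating_sum_affine using False by simp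
        show "v (next_edge D e) i = (if even n then v e i + 2 * under_sign D e * ?\<Delta>
            else if even (under_sign D e) then v e i else 2 * ?\<Delta> - v e i)"
          if "e \<in> edges D" for e i
          using False w h[OF that] by (auto simp: v_def)
      qed
      then show thesis by (rule that) (simp add: v_def h0)
    next
      case w: False
      then obtain c where c: "\<forall>i\<in>{1..n}. a i = c"
        using a False by (auto simp: closing_condition_def)
      have "alternating_sum n (\<lambda>i. 0 * a i + c) = c"
        unfolding alternating_sum_affine using False by simp
      then have "strand_coloring n D (\<lambda>e i. c)"
        using False by (intro strand_coloringI[OF wf, where \<Delta> = c]) auto
      then show thesis by (rule that) (use c in simp)
    qed
  qed
qed

lemma closing_condition_cong:
  assumes "\<And>i. i \<in> {1..n} \<Longrightarrow> a i = b i"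
  shows "closing_condition n w a \<longleftrightarrow> closing_condition n w b"
proof -
  have "alternating_sum n a = alternating_sum n b"
    using assms by (rule alternating_sum_cong)
  moreover have "(\<forall>i\<in>{1..n}. a i = c) \<longleftrightarrow> (\<forall>i\<in>{1..n}. b i = c)" for c
    using assms by auto
  ultimately show ?thesis
    by (simp only: closing_condition_def)
qed

text \<open>
  Numbering the parallel arcs from the other side changes the alternating sum at most by a sign.
\<close>

lemma closing_condition_rev:
  "closing_condition n w (\<lambda>i. a (n + 1 - i)) \<longleftrightarrow> closing_condition n w a"
proof -
  have "bij_betw (\<lambda>i. n + 1 - i) {1..n} {1..n}"
    by (rule bij_betw_byWitness[of _ "\<lambda>i. n + 1 - i"]) auto
  then have "{1..n} = (\<lambda>i. n + 1 - i) ` {1..n}"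
    by (simp add: bij_betw_def)
  then have "(\<forall>i\<in>{1..n}. a (n + 1 - i) = c) \<longleftrightarrow> (\<forall>i\<in>{1..n}. a i = c)" for c
    by (metis (no_types, lifting) imageE imageI)
  then show ?thesis
    unfolding closing_condition_def alternating_sum_rev by auto
qed

section \<open>Restriction to the parallels of an arc\<close>

lemma knot_parallel_colorings:
  assumes knot: "knot_diagram D" and n: "n \<ge> 1" and \<alpha>: "\<alpha> \<in> arcs D"
  shows colorings_parallel_eqI: "\<And>C C'.
      C \<in> colorings (parallel n D) \<Longrightarrow> C' \<in> colorings (parallel n D) \<Longrightarrow>
      (\<And>i. i \<in> {1..n} \<Longrightarrow> C (parallel_arc n D \<alpha> i) = C' (parallel_arc n D \<alpha> i)) \<Longrightarrow> C = C'"
    and ex_coloring_parallel_iff: "\<And>a.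
      (\<exists>C\<in>colorings (parallel n D). \<forall>i\<in>{1..n}. C (parallel_arc n D \<alpha> i) = a i)
      \<longleftrightarrow> closing_condition n (writhe D) a"
proof -
  let ?P = "parallel n D"
  have wf: "well_formed D"
    using knot by (simp add: knot_diagram_def link_diagram_def)
  obtain e where e: "e \<in> edges D" "e \<in> \<alpha>"
    using \<alpha> by (auto simp: arcs_eq arc_of_def)
  have arc: "parallel_arc n D \<alpha> i = arc_of ?P (Copy e i)" if "i \<in> {1..n}" for i
    using parallel_arc_eq[OF \<alpha> e(2) that] .
  have strand: "strand_coloring n D (\<lambda>e i. C (arc_of ?P (Copy e i)))" if "C \<in> colorings ?P" for C
    using that by (intro strand_coloring_of_edge_coloring[OF wf n] edge_coloring_of_coloring)
  {
    fix C C' assume C: "C \<in> colorings ?P" and C': "C' \<in> colorings ?P"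
      and eq: "\<And>i. i \<in> {1..n} \<Longrightarrow> C (parallel_arc n D \<alpha> i) = C' (parallel_arc n D \<alpha> i)"
    have copies: "C (arc_of ?P (Copy f i)) = C' (arc_of ?P (Copy f i))"
      if "f \<in> edges D" "i \<in> {1..n}" for f i
      using strand_coloring_unique[OF knot strand[OF C] strand[OF C'] e(1) that(1) _ that(2)]
        eq arc by simp
    have "C (arc_of ?P f) = C' (arc_of ?P f)" if "f \<in> edges ?P" for f
      using edge_coloring_parallel_eqI[OF edge_coloring_of_coloring[OF C]
          edge_coloring_of_coloring[OF C'] wf copies that] .
    then have "C \<beta> = C' \<beta>" if "\<beta> \<in> arcs ?P" for \<beta>
      using that by (auto simp: arcs_eq)
    with C C' show "C = C'"
      by (auto simp: colorings_def intro: PiE_ext)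
  next
    fix a
    show "(\<exists>C\<in>colorings ?P. \<forall>i\<in>{1..n}. C (parallel_arc n D \<alpha> i) = a i)
      \<longleftrightarrow> closing_condition n (writhe D) a"
    proof
      assume "\<exists>C\<in>colorings ?P. \<forall>i\<in>{1..n}. C (parallel_arc n D \<alpha> i) = a i"
      then obtain C where C: "C \<in> colorings ?P"
        and a: "\<And>i. i \<in> {1..n} \<Longrightarrow> C (arc_of ?P (Copy e i)) = a i"
        using arc by auto
      have "closing_condition n (writhe D) (\<lambda>i. C (arc_of ?P (Copy e i)))"
        by (rule strand_coloring_closes_up[OF knot strand[OF C] e(1) n])
      then show "closing_condition n (writhe D) a"
        using closing_condition_cong[of n _ a, OF a] by simp
    next
      assume "closing_condition n (writhe D) a"
      then obtain v where v: "strand_coloring n D v" and va: "\<And>i. i \<in> {1..n} \<Longrightarrow> v e i = a i"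
        using strand_coloring_exists[OF knot e(1)] by blast
      obtain c where c: "edge_coloring ?P c" and cv: "\<And>e i. c (Copy e i) = v e i"
        using edge_coloring_of_strand_coloring[OF wf n v] by blast
      obtain C where C: "C \<in> colorings ?P" and Cc: "\<And>f. f \<in> edges ?P \<Longrightarrow> C (arc_of ?P f) = c f"
        using coloring_of_edge_coloring[OF well_formed_parallel[OF wf n] c] by blast
      have "C (parallel_arc n D \<alpha> i) = a i" if i: "i \<in> {1..n}" for i
      proof -
        have "Copy e i \<in> edges ?P"
          using e(1) i by (auto simp: parallel_def)
        with Cc cv va[OF i] arc[OF i] show ?thesis by simp
      qed
      with C show "\<exists>C\<in>colorings ?P. \<forall>i\<in>{1..n}. C (parallel_arc n D \<alpha> i) = a i"
        by blast
    qed
  }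
qed

theorem theorem4p1:
  fixes D :: "('x, 'e) diagram" and n :: nat and \<alpha> :: "'e set"
    and \<gamma> :: "nat \<Rightarrow> ('x, 'e) parallel_edge set"
    and r :: "(('x, 'e) parallel_edge set \<Rightarrow> int) \<Rightarrow> nat \<Rightarrow> int"
  assumes "knot_diagram D" and "n \<ge> 1" and "\<alpha> \<in> arcs D"
    and "(\<forall>i\<in>{1..n}. \<gamma> i = parallel_arc n D \<alpha> i) \<or>
         (\<forall>i\<in>{1..n}. \<gamma> i = parallel_arc n D \<alpha> (n + 1 - i))"
    and "r = (\<lambda>C. \<lambda>i\<in>{1..n}. C (\<gamma> i))"
  shows "r \<in> hom (coloring_group (parallel n D)) (int_vectors n) \<and>
    inj_on r (colorings (parallel n D)) \<and>
    r ` colorings (parallel n D) =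
      (if even n then
         {a \<in> carrier (int_vectors n). writhe D * (\<Sum>i=1..n. (-1) ^ (i + 1) * a i) = 0}
       else if odd (writhe D) then
         {a \<in> carrier (int_vectors n). \<exists>c. \<forall>i\<in>{1..n}. a i = c}
       else carrier (int_vectors n))"
proof -
  let ?P = "parallel n D"
  let ?\<pi> = "\<lambda>i. parallel_arc n D \<alpha> i"
  have carrier: "carrier (int_vectors n) = {1..n} \<rightarrow>\<^sub>E UNIV"
    by (simp add: int_vectors_def)
  \<comment> \<open>\<open>\<rho>\<close> translates between the given numbering of the arcs and that from left to right.\<close>
  obtain \<rho> where \<rho>: "\<rho> = (\<lambda>i. i) \<or> \<rho> = (\<lambda>i. n + 1 - i)"
    and \<gamma>: "\<And>i. i \<in> {1..n} \<Longrightarrow> \<gamma> i = ?\<pi> (\<rho> i)"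
    using assms(4) by (elim disjE) (rule that, auto)+
  have \<rho>_in: "\<rho> i \<in> {1..n}" and \<rho>_invol: "\<rho> (\<rho> i) = i" if "i \<in> {1..n}" for i
    using \<rho> that by auto
  have r: "r C i = C (?\<pi> (\<rho> i))" if "i \<in> {1..n}" for C i
    using that \<gamma> assms(5) by simp
  have r_ext: "r C \<in> {1..n} \<rightarrow>\<^sub>E UNIV" for C
    by (simp add: assms(5))
  have hom: "r \<in> hom (coloring_group ?P) (int_vectors n)"
  proof (rule homI)
    show "r C \<in> carrier (int_vectors n)" for C
      unfolding carrier by (rule r_ext)
    show "r (C \<otimes>\<^bsub>coloring_group ?P\<^esub> C') = r C \<otimes>\<^bsub>int_vectors n\<^esub> r C'" for C C'
    proof -
      have "\<gamma> i \<in> arcs ?P" if "i \<in> {1..n}" for i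
        using \<gamma>[OF that] parallel_arc_in_arcs[OF assms(3) \<rho>_in[OF that]] by simp
      then show ?thesis
        by (auto simp: assms(5) coloring_group_def int_vectors_def product_group_def)
    qed
  qed
  have inj: "inj_on r (colorings ?P)"
  proof (rule inj_onI)
    fix C C' assume C: "C \<in> colorings ?P" "C' \<in> colorings ?P" and eq: "r C = r C'"
    have "C (?\<pi> i) = C' (?\<pi> i)" if "i \<in> {1..n}" for i
      using r[OF \<rho>_in[OF that], of C] r[OF \<rho>_in[OF that], of C'] \<rho>_invol[OF that] eq by simp
    with C show "C = C'"
      by (rule colorings_parallel_eqI[OF assms(1-3)])
  qed
  have img: "a \<in> r ` colorings ?P \<longleftrightarrow> closing_condition n (writhe D) a"
    if a: "a \<in> {1..n} \<rightarrow>\<^sub>E UNIV" for a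
  proof -
    have "a = r C \<longleftrightarrow> (\<forall>i\<in>{1..n}. C (?\<pi> i) = a (\<rho> i))" for C
    proof -
      have "a = r C \<longleftrightarrow> (\<forall>i\<in>{1..n}. C (?\<pi> (\<rho> i)) = a i)"
        using r a r_ext by (metis PiE_ext)
      also have "\<dots> \<longleftrightarrow> (\<forall>i\<in>{1..n}. C (?\<pi> i) = a (\<rho> i))"
        using \<rho>_in \<rho>_invol by metis
      finally show ?thesis .
    qed
    then have "a \<in> r ` colorings ?P \<longleftrightarrow> closing_condition n (writhe D) (\<lambda>i. a (\<rho> i))"
      unfolding ex_coloring_parallel_iff[OF assms(1-3), symmetric] by blast
    also have "\<dots> \<longleftrightarrow> closing_condition n (writhe D) a"
      using \<rho> closing_condition_rev by auto
    finally show ?thesis .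
  qed
  have "r ` colorings ?P = {a \<in> carrier (int_vectors n). closing_condition n (writhe D) a}"
    using img r_ext unfolding carrier by blast
  with hom inj show ?thesis
    by (auto simp: closing_condition_def alternating_sum_def)
qed

end
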